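(* Set $u=\dfrac{x(1-t)}{(1+tx)(1+t^2x)}$, where $x$ is a new variable. The generating function $R(t;u,v)$ of triangular prudent walks ending on the right edge of their box satisfies $$R(t;u,tu)=(1+xt)(1+xt^2)\sum_{k\ge0}\frac{t^{\binom{k+1}{2}}\left(xt(1-2t^2)\right)^k}{\left(xt(1-2t^2);t\right)_{k+1}}\left(\frac{xt^3}{1-2t^2};t\right)_k,$$ where $(a;q)_n=(1-a)(1-aq)\cdots(1-aq^{n-1})$. The generating function $P(t;u)$ of triangular prudent walks, counted by their length and the size of the box, is $$P(t;u)=1+\frac{6tu(1+t)}{1-t-2tu(1+t)}\Big(1+t\left(2u(1+t)-1\right)R(t;u,tu)\Big).$$
   Context: Walks on the triangular lattice start at the origin and take unit steps E, NE, NW, W, SW, SE. The box of a walk is the smallest (possibly degenerate) equilateral triangle pointing North (one horizontal bottom edge, corners SW, SE and N, sides along lattice lines) that contains the walk; its size is its side length. A walk is a triangular prudent walk if each new step either inflates the box (makes the box of the walk constructed so far larger), or walks along one edge of the box in a prudent way, that is, not pointing towards an already visited vertex (no vertex $p+kd$, $k\ge 1$, already visited, where $p$ is the current endpoint and $d$ the step direction). The empty walk is included. $R(t;u,v)=\sum t^n u^i v^j$, where the sum is over all triangular prudent walks ending on the right edge of their box, $n$ is the length, $i$ is the distance between the endpoint and the SE corner of the box, and $j$ the distance between the endpoint and the N corner. $P(t;u)=\sum t^nu^k$ over all triangular prudent walks, $n$ being the length and $k$ the size of the box. These are power series in $t$ with coefficients that are polynomials in the other variables; in the first identity both sides are power series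 in $t$ with coefficients that are polynomials in $x$. *)

theory Defs
  imports "HOL-Computational_Algebra.Computational_Algebra" "HOL-Library.Product_Plus"
begin

section \<open>Walks on the triangular lattice\<close>

text \<open>
  The lattice point (a, b) stands for a E + b NE. In these coordinates the lines
  parallel to the bottom, left and right edges of a triangle pointing North are
  b = const, a = const and a + b = const, respectively.
\<close>

type_synonym point = "int \<times> int"

datatype step = E | NE | NW | W | SW | SE

type_synonym walk = "step list"

fun vec :: "step \<Rightarrow> point" where
  "vec E = (1, 0)"
| "vec NE = (0, 1)"
| "vec NW = (-1, 1)"
| "vec W = (-1, 0)"
| "vec SW = (0, -1)"
| "vec SE = (1, -1)"

definition scale :: "int \<Rightarrow> point \<Rightarrow> point" where
  "scale k p = (k * fst p, k * snd p)"

definition endpoint :: "walk \<Rightarrow> point" where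
  "endpoint w = sum_list (map vec w)"

definition visited :: "walk \<Rightarrow> point set" where
  "visited w = (\<lambda>k. endpoint (take k w)) ` {..length w}"

text \<open>
  Graph distance of the lattice; for two points on a common lattice line it is also
  their Euclidean distance (with unit steps).
\<close>

definition lattice_dist :: "point \<Rightarrow> point \<Rightarrow> nat" where
  "lattice_dist p q =
     (let a = fst q - fst p; b = snd q - snd p in nat (max \<bar>a\<bar> (max \<bar>b\<bar> \<bar>a + b\<bar>)))"


section \<open>The box of a walk\<close>

text \<open>The triangle pointing North with South-West corner c and side length k:\<close>

definition triangle :: "point \<Rightarrow> nat \<Rightarrow> point set" where
  "triangle c k = {c + scale i (vec E) + scale j (vec NE) | i j. 0 \<le> i \<and> 0 \<le> j \<and> i + j \<le> int k}"

definition is_box :: "walk \<Rightarrow> point \<times> nat \<Rightarrow> bool" where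
  "is_box w = (\<lambda>(c, k). visited w \<subseteq> triangle c k \<and>
     (\<forall>c' k'. visited w \<subseteq> triangle c' k' \<longrightarrow> triangle c k \<subseteq> triangle c' k'))"

text \<open>Existence and uniqueness of the box is shown in lemma is_box_iff below.\<close>

definition box :: "walk \<Rightarrow> point \<times> nat" where
  "box w = (THE B. is_box w B)"

definition box_size :: "walk \<Rightarrow> nat" where
  "box_size w = snd (box w)"

definition corner_SW :: "walk \<Rightarrow> point" where
  "corner_SW w = fst (box w)"

definition corner_SE :: "walk \<Rightarrow> point" where
  "corner_SE w = corner_SW w + scale (int (box_size w)) (vec E)"

definition corner_N :: "walk \<Rightarrow> point" where
  "corner_N w = corner_SW w + scale (int (box_size w)) (vec NE)"

definition bottom_edge :: "walk \<Rightarrow> point set" where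
  "bottom_edge w = {corner_SW w + scale i (vec E) | i. 0 \<le> i \<and> i \<le> int (box_size w)}"

definition left_edge :: "walk \<Rightarrow> point set" where
  "left_edge w = {corner_SW w + scale i (vec NE) | i. 0 \<le> i \<and> i \<le> int (box_size w)}"

definition right_edge :: "walk \<Rightarrow> point set" where
  "right_edge w = {corner_SE w + scale i (vec NW) | i. 0 \<le> i \<and> i \<le> int (box_size w)}"


section \<open>Triangular prudent walks\<close>

definition inflates :: "walk \<Rightarrow> step \<Rightarrow> bool" where
  "inflates w d \<longleftrightarrow> box_size w < box_size (w @ [d])"

definition along_edge :: "walk \<Rightarrow> step \<Rightarrow> bool" where
  "along_edge w d \<longleftrightarrow>
     (\<exists>e \<in> {bottom_edge w, left_edge w, right_edge w}. endpoint w \<in> e \<and> endpoint w + vec d \<in> e)"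

definition points_to_visited :: "walk \<Rightarrow> step \<Rightarrow> bool" where
  "points_to_visited w d \<longleftrightarrow> (\<exists>k\<ge>1. endpoint w + scale k (vec d) \<in> visited w)"

definition prudent :: "walk \<Rightarrow> bool" where
  "prudent w \<longleftrightarrow> (\<forall>k<length w.
     let w' = take k w; d = w ! k
     in inflates w' d \<or> along_edge w' d \<and> \<not> points_to_visited w' d)"


section \<open>Generating functions\<close>

definition walks_right :: "nat \<Rightarrow> walk set" where
  "walks_right n = {w. prudent w \<and> length w = n \<and> endpoint w \<in> right_edge w}"

definition dist_SE :: "walk \<Rightarrow> nat" where
  "dist_SE w = lattice_dist (endpoint w) (corner_SE w)"

definition dist_N :: "walk \<Rightarrow> nat" where
  "dist_N w = lattice_dist (endpoint w) (corner_N w)"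

text \<open>
  Power series in t over Z[u][v]: the indeterminate u belongs to the inner polynomials,
  v to the outer ones, so \<open>monom (monom 1 i) j\<close> is \<open>u^i v^j\<close>.
\<close>

definition R_gf :: "int poly poly fps" where
  "R_gf = Abs_fps (\<lambda>n. \<Sum>w\<in>walks_right n. monom (monom 1 (dist_SE w)) (dist_N w))"

definition P_gf :: "int poly fps" where
  "P_gf = Abs_fps (\<lambda>n. \<Sum>w | prudent w \<and> length w = n. monom 1 (box_size w))"

definition eval2 :: "int poly poly \<Rightarrow> 'a::comm_ring_1 \<Rightarrow> 'a \<Rightarrow> 'a" where
  "eval2 f a b = poly (map_poly (\<lambda>p. poly (map_poly of_int p) a) f) b"

text \<open>
  F(t; U, V), where U and V may themselves depend on t. The series converges in the t-adic
  topology of \<open>fps\<close>; see lemma summable_subst2 below.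
\<close>

definition subst2 :: "int poly poly fps \<Rightarrow> 'a::comm_ring_1 fps \<Rightarrow> 'a fps \<Rightarrow> 'a fps" where
  "subst2 F U V = (\<Sum>n. fps_X ^ n * eval2 (F $ n) U V)"

text \<open>
  The inverse of a power series with constant term 1 over an arbitrary commutative ring
  (the library's \<open>inverse\<close> on \<open>fps\<close> needs inverses of coefficients, which polynomials lack).
\<close>

definition recip :: "'a::comm_ring_1 fps \<Rightarrow> 'a fps" where
  "recip f = fps_right_inverse f 1"

definition qpoch :: "'a::comm_ring_1 \<Rightarrow> 'a \<Rightarrow> nat \<Rightarrow> 'a" where
  "qpoch a q n = (\<Prod>i<n. 1 - a * q ^ i)"


section \<open>Well-definedness\<close>

lemma mult_recip: "f $ 0 = 1 \<Longrightarrow> f * recip f = 1"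
  unfolding recip_def by (rule fps_right_inverse) simp

lemma finite_walks_length: "finite {w :: walk. length w = n \<and> P w}"
proof -
  have "(UNIV :: step set) = {E, NE, NW, W, SW, SE}"
    using step.exhaust by blast
  then have "finite (UNIV :: step set)"
    by (metis finite.emptyI finite_insert)
  then have "finite {w :: walk. set w \<subseteq> UNIV \<and> length w = n}"
    by (rule finite_lists_length_eq)
  then show ?thesis
    by (rule rev_finite_subset) auto
qed

lemma summable_fps_X_power_mult:
  fixes g :: "nat \<Rightarrow> 'a::comm_ring_1 fps"
  shows "summable (\<lambda>n. fps_X ^ n * g n)"
proof -
  have nth: "(\<Sum>n<N. fps_X ^ n * g n) $ m = (\<Sum>n\<le>m. (fps_X ^ n * g n) $ m)" if "m < N" for m N
    unfolding fps_sum_nth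
    by (rule sum.mono_neutral_right) (use that in \<open>auto simp: fps_X_power_mult_nth\<close>)
  have "(\<lambda>N. \<Sum>n<N. fps_X ^ n * g n) \<longlonglongrightarrow> Abs_fps (\<lambda>m. \<Sum>n\<le>m. (fps_X ^ n * g n) $ m)"
    by (rule tendsto_fpsI)
       (use nth in \<open>auto intro: eventually_mono[OF eventually_gt_at_top]\<close>)
  then show ?thesis
    unfolding summable_def sums_def by blast
qed

lemma summable_subst2: "summable (\<lambda>n. fps_X ^ n * eval2 (F $ n) U V)"
  by (rule summable_fps_X_power_mult)

lemma in_triangle_iff:
  "p \<in> triangle c k \<longleftrightarrow> fst c \<le> fst p \<and> snd c \<le> snd p \<and> fst p + snd p \<le> fst c + snd c + int k"
proof
  assume "fst c \<le> fst p \<and> snd c \<le> snd p \<and> fst p + snd p \<le> fst c + snd c + int k"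
  then show "p \<in> triangle c k"
    unfolding triangle_def
    by (intro CollectI exI[of _ "fst p - fst c"] exI[of _ "snd p - snd c"])
       (auto simp: scale_def prod_eq_iff)
qed (auto simp: triangle_def scale_def)

lemma triangle_subset_iff:
  "triangle c k \<subseteq> triangle c' k' \<longleftrightarrow>
     fst c' \<le> fst c \<and> snd c' \<le> snd c \<and> fst c + snd c + int k \<le> fst c' + snd c' + int k'"
proof
  assume sub: "triangle c k \<subseteq> triangle c' k'"
  have "c \<in> triangle c k" "c + (int k, 0) \<in> triangle c k"
    by (auto simp: in_triangle_iff)
  with sub have "c \<in> triangle c' k'" "c + (int k, 0) \<in> triangle c' k'"
    by blast+
  then show "fst c' \<le> fst c \<and> snd c' \<le> snd c \<and>
      fst c + snd c + int k \<le> fst c' + snd c' + int k'"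
    by (auto simp: in_triangle_iff)
qed (auto simp: in_triangle_iff)

lemma is_box_iff:
  fixes w
  defines "a \<equiv> Min (fst ` visited w)" and "b \<equiv> Min (snd ` visited w)"
    and "s \<equiv> Max ((\<lambda>p. fst p + snd p) ` visited w)"
  shows "is_box w B \<longleftrightarrow> B = ((a, b), nat (s - a - b))"
proof -
  have fin: "finite (visited w)" and ne: "visited w \<noteq> {}"
    by (auto simp: visited_def)
  obtain p where p: "p \<in> visited w" using ne by blast
  have "a \<le> fst p" "b \<le> snd p" "fst p + snd p \<le> s"
    using fin p by (auto simp: a_def b_def s_def)
  then have k: "int (nat (s - a - b)) = s - a - b" by simp
  have sub: "visited w \<subseteq> triangle c m \<longleftrightarrow>
      fst c \<le> a \<and> snd c \<le> b \<and> s \<le> fst c + snd c + int m" for c m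
    using fin ne by (auto simp: a_def b_def s_def subset_iff in_triangle_iff)
  show ?thesis
  proof
    assume B: "is_box w B"
    obtain c m where Bc: "B = (c, m)" by (cases B)
    have "visited w \<subseteq> triangle c m" "triangle c m \<subseteq> triangle (a, b) (nat (s - a - b))"
      using B k sub[of "(a, b)" "nat (s - a - b)"] by (auto simp: Bc is_box_def)
    then show "B = ((a, b), nat (s - a - b))"
      using k unfolding sub triangle_subset_iff Bc by (auto simp: prod_eq_iff)
  next
    assume "B = ((a, b), nat (s - a - b))"
    then show "is_box w B"
      using k by (auto simp: is_box_def sub triangle_subset_iff)
  qed
qed

lemma box_eq:
  "box w = (let a = Min (fst ` visited w); b = Min (snd ` visited w);
                s = Max ((\<lambda>p. fst p + snd p) ` visited w)
            in ((a, b), nat (s - a - b)))"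
  unfolding box_def is_box_iff by (simp add: Let_def)

end

theory Submission
  imports Defs
begin

text \<open>
  A box is described by three edges, and a point by its depths, i.e. its distances to the lines
  through the three edges; the sum of the three depths of any point of the box is the size of
  the box. Each of the six steps moves toward one edge, away from another one and parallel to
  the third, so the depths of the endpoint evolve without any reference to the position of the
  box. A step inflates the box exactly if the depth with respect to the edge it moves toward
  is 0.

  The prudence condition is local as well. When an edge is inflated, it contains no visited point
  except the new endpoint, whereas the two other edges contain visited points off the new edge,
  so the walk can never slide along them away from the new edge. Hence a prudent walk is a
  sequence of inflations, each followed by a straight run (possibly empty) along the
  new edge (\<open>prudent_snoc_iff\<close>). The symmetric group of the three edges acts on these
  walks, so it suffices to study those whose last inflated edge is the right one.

  Write \<open>t\<close> for the length variable, \<open>A\<close> for the series of the walks that have just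
  inflated the right edge, \<open>Y(a,b)\<close> and \<open>Y(b,a)\<close> for those running along it toward
  North-West and South-East, and \<open>C(a)\<close> for the walks based on the right edge that end at
  the N corner. Removal of the last step gives \<open>A = t (a + b) R\<close> and
  \<open>b Y = t a (A + Y - C(a))\<close>. Setting \<open>b = t a\<close> in the latter cancels \<open>Y\<close> and yields
  \<open>C(a) = t (1 + t) a R(a, t a)\<close>. By symmetry \<open>R = 1 + A + Y(a,b) + Y(b,a) + C(a) + C(b)\<close>,
  and elimination leads to a linear equation (\<open>kernel_equation\<close>) for \<open>R(a,b)\<close>, with
  \<open>R(a, t a)\<close> and \<open>R(b, t b)\<close> on the right-hand side and with the kernel
  \<open>(b - t a) (a - t b) - t a b (a + b) (1 - t^2)\<close>.

  The zero set of the kernel is a rational curve: the kernel vanishes at \<open>a = u(y)\<close>, \<open>b = u(t y)\<close>, where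
  \<open>u(y) = y (1 - t) / ((1 + t y) (1 + t^2 y))\<close>. On this curve the equation relates
  \<open>R(u(y), t u(y))\<close> to the same series at \<open>t y\<close> (\<open>normalized_right_step\<close>).
  Iterating it from \<open>y = x\<close> converges \<open>t\<close>-adically to the q-series of the theorem
  (\<open>iterate_linear_recursion\<close>).

  Finally, every nonempty prudent walk is based on exactly one of three edges, so \<open>P\<close> is
  \<open>1 + 3 (A + 2 Y)\<close> on the diagonal \<open>a = b = u\<close>, and the same equations express this
  through \<open>R(u, t u)\<close> (\<open>gf_based_diagonal\<close>).
\<close>

section \<open>Heights and depths\<close>

datatype edge = Bottom | Left | Right

text \<open>
  Each height grows from the edge line into the triangle, with the same normalization for the
  three edges, so that the heights of a point add up to 0. This treats the edges symmetrically.
\<close>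

fun height :: "edge \<Rightarrow> point \<Rightarrow> int" where
  "height Bottom p = snd p"
| "height Left p = fst p"
| "height Right p = - fst p - snd p"

fun away :: "step \<Rightarrow> edge" where
  "away E = Left" | "away NE = Bottom" | "away NW = Bottom"
| "away W = Right" | "away SW = Right" | "away SE = Left"

fun toward :: "step \<Rightarrow> edge" where
  "toward E = Right" | "toward NE = Right" | "toward NW = Left"
| "toward W = Left" | "toward SW = Bottom" | "toward SE = Bottom"

fun parallel :: "step \<Rightarrow> edge" where
  "parallel E = Bottom" | "parallel NE = Left" | "parallel NW = Right"
| "parallel W = Bottom" | "parallel SW = Left" | "parallel SE = Right"

lemma directions_distinct:
  "away s \<noteq> toward s" "away s \<noteq> parallel s" "toward s \<noteq> parallel s"
  by (cases s; simp)+

lemma edge_cases_step: "e = away s \<or> e = toward s \<or> e = parallel s"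
  by (cases s; cases e; simp)

lemma height_ray:
  "height e (p + scale k (vec s)) = height e p + k * (of_bool (e = away s) - of_bool (e = toward s))"
  by (cases s; cases e; simp add: scale_def)

lemma height_step:
  "height e (p + vec s) = height e p + of_bool (e = away s) - of_bool (e = toward s)"
  by (cases s; cases e; simp)

lemma point_eqI_height:
  assumes "e \<noteq> e'" "height e p = height e q" "height e' p = height e' q"
  shows "p = q"
  using assms by (cases e; cases e'; simp add: prod_eq_iff)

lemma visited_finite [simp]: "finite (visited w)"
  and visited_nonempty [simp]: "visited w \<noteq> {}"
  by (auto simp: visited_def)

lemma endpoint_snoc [simp]: "endpoint (w @ [s]) = endpoint w + vec s"
  by (simp add: endpoint_def)

lemma visited_snoc: "visited (w @ [s]) = insert (endpoint w + vec s) (visited w)"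
proof -
  have "visited (w @ [s]) = (\<lambda>k. endpoint (take k (w @ [s]))) ` insert (Suc (length w)) {..length w}"
    by (simp add: visited_def atMost_Suc)
  also have "\<dots> = insert (endpoint w + vec s) ((\<lambda>k. endpoint (take k (w @ [s]))) ` {..length w})"
    by simp
  also have "(\<lambda>k. endpoint (take k (w @ [s]))) ` {..length w} = visited w"
    unfolding visited_def by (intro image_cong) auto
  finally show ?thesis .
qed

lemma endpoint_visited: "endpoint w \<in> visited w"
  unfolding visited_def by (rule image_eqI[of _ _ "length w"]) auto

definition lowest :: "edge \<Rightarrow> walk \<Rightarrow> int" where
  "lowest e w = Min (height e ` visited w)"

definition depth :: "edge \<Rightarrow> walk \<Rightarrow> nat" where
  "depth e w = nat (height e (endpoint w) - lowest e w)"

lemma lowest_le: "p \<in> visited w \<Longrightarrow> lowest e w \<le> height e p"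
  by (simp add: lowest_def)

lemma lowest_attained: obtains p where "p \<in> visited w" "height e p = lowest e w"
proof -
  have "lowest e w \<in> height e ` visited w"
    unfolding lowest_def by (rule Min_in) auto
  then show ?thesis using that by auto
qed

lemma lowest_snoc: "lowest e (w @ [s]) = min (height e (endpoint w + vec s)) (lowest e w)"
  by (simp add: lowest_def visited_snoc)

lemma height_endpoint: "height e (endpoint w) = lowest e w + int (depth e w)"
  using lowest_le[OF endpoint_visited, of e w] by (simp add: depth_def)

lemma depth_Nil [simp]: "depth e [] = 0"
  by (cases e) (simp_all add: depth_def lowest_def visited_def endpoint_def)

text \<open>
  Truncated subtraction on the naturals is what makes this formula uniform: a step toward an edge
  at depth 0 moves that edge along, and the depth stays 0.
\<close>

lemma depth_snoc:
  "depth e (w @ [s]) = depth e w + of_bool (e = away s) - of_bool (e = toward s)"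
proof -
  have "int (depth e (w @ [s])) = height e (endpoint w + vec s) - lowest e (w @ [s])"
    using height_endpoint[of e "w @ [s]"] by simp
  then show ?thesis
    using height_endpoint[of e w] directions_distinct[of s]
    by (auto simp: lowest_snoc height_step of_bool_def min_def split: if_splits)
qed

lemma box_coords:
  "corner_SW w = (lowest Left w, lowest Bottom w)" (is ?c)
  "box_size w = depth Bottom w + depth Left w + depth Right w" (is ?s)
proof -
  have "Max ((\<lambda>p. fst p + snd p) ` visited w) = - lowest Right w"
  proof (rule Max_eqI)
    show "y \<le> - lowest Right w" if "y \<in> (\<lambda>p. fst p + snd p) ` visited w" for y
      using that lowest_le[of _ w Right] by fastforce
    obtain p where "p \<in> visited w" "height Right p = lowest Right w"
      by (rule lowest_attained)
    then show "- lowest Right w \<in> (\<lambda>p. fst p + snd p) ` visited w"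
      by (intro image_eqI[of _ _ p]) auto
  qed simp
  moreover have "height Left = fst" "height Bottom = snd"
    by auto
  ultimately have "box w = ((lowest Left w, lowest Bottom w),
      nat (- lowest Right w - lowest Left w - lowest Bottom w))"
    by (simp add: box_eq lowest_def)
  then show ?c ?s
    using height_endpoint[of Left w] height_endpoint[of Right w] height_endpoint[of Bottom w]
    by (simp_all add: corner_SW_def box_size_def)
qed

lemma inflates_iff: "inflates w s \<longleftrightarrow> depth (toward s) w = 0"
  unfolding inflates_def box_coords depth_snoc by (cases s) auto

text \<open>
  A description of the edges of the box that does not single out any corner.
\<close>

definition edge_points :: "edge \<Rightarrow> walk \<Rightarrow> point set" where
  "edge_points e w = {p. height e p = lowest e w \<and> (\<forall>e'. lowest e' w \<le> height e' p)}"

lemma all_edges: "(\<forall>e. Q e) \<longleftrightarrow> Q Bottom \<and> Q Left \<and> Q Right"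
  by (metis edge.exhaust)

lemma any_edge: "(\<exists>e. Q e) \<longleftrightarrow> Q Bottom \<or> Q Left \<or> Q Right"
  by (metis edge.exhaust)

lemma edges_of_box:
  "bottom_edge w = edge_points Bottom w"
  "left_edge w = edge_points Left w"
  "right_edge w = edge_points Right w"
proof -
  have size: "int (box_size w) = - lowest Right w - lowest Left w - lowest Bottom w"
    using height_endpoint[of Left w] height_endpoint[of Right w] height_endpoint[of Bottom w]
    by (simp add: box_coords)
  have "bottom_edge w = {(lowest Left w + i, lowest Bottom w) | i. 0 \<le> i \<and> i \<le> int (box_size w)}"
    by (simp add: bottom_edge_def box_coords(1) scale_def)
  also have "\<dots> = edge_points Bottom w"
    unfolding edge_points_def size all_edges
    by (intro set_eqI, case_tac x)
       (auto, rule exI[of _ "a - lowest Left w" for a], auto)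
  finally show "bottom_edge w = edge_points Bottom w" .
  have "left_edge w = {(lowest Left w, lowest Bottom w + i) | i. 0 \<le> i \<and> i \<le> int (box_size w)}"
    by (simp add: left_edge_def box_coords(1) scale_def)
  also have "\<dots> = edge_points Left w"
    unfolding edge_points_def size all_edges
    by (intro set_eqI, case_tac x)
       (auto, rule exI[of _ "b - lowest Bottom w" for b], auto)
  finally show "left_edge w = edge_points Left w" .
  have "right_edge w = {(lowest Left w + int (box_size w) - i, lowest Bottom w + i) | i.
      0 \<le> i \<and> i \<le> int (box_size w)}"
    by (simp add: right_edge_def corner_SE_def box_coords(1) scale_def)
  also have "\<dots> = edge_points Right w"
    unfolding edge_points_def size all_edges
    by (intro set_eqI, case_tac x)
       (auto, rule exI[of _ "b - lowest Bottom w" for b], auto)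
  finally show "right_edge w = edge_points Right w" .
qed

lemma endpoint_in_edge_iff: "endpoint w \<in> edge_points e w \<longleftrightarrow> depth e w = 0"
  by (auto simp: edge_points_def height_endpoint)

lemma next_in_edge_iff:
  "endpoint w + vec s \<in> edge_points e w \<longleftrightarrow>
     int (depth e w) + of_bool (e = away s) = of_bool (e = toward s) \<and> depth (toward s) w > 0"
  using directions_distinct[of s]
  by (auto simp: edge_points_def height_step height_endpoint of_bool_def split: if_splits)

lemma along_edge_iff:
  "along_edge w s \<longleftrightarrow> depth (parallel s) w = 0 \<and> depth (toward s) w > 0"
proof -
  have "along_edge w s \<longleftrightarrow> (\<exists>e. endpoint w \<in> edge_points e w \<and> endpoint w + vec s \<in> edge_points e w)"
    unfolding along_edge_def edges_of_box any_edge by blast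
  also have "\<dots> \<longleftrightarrow> depth (parallel s) w = 0 \<and> depth (toward s) w > 0"
    unfolding endpoint_in_edge_iff next_in_edge_iff
    unfolding any_edge by (cases s) (auto simp: of_bool_def)
  finally show ?thesis .
qed

lemma prudent_Nil [simp]: "prudent []"
  by (simp add: prudent_def)

lemma prudent_snoc:
  "prudent (w @ [s]) \<longleftrightarrow> prudent w \<and> (inflates w s \<or> along_edge w s \<and> \<not> points_to_visited w s)"
  by (auto simp: prudent_def Let_def less_Suc_eq nth_append)

section \<open>A local description of prudence\<close>

text \<open>
  The last step of a fresh walk is an inflation. The base of a nonempty prudent walk is the edge
  inflated last: it is the edge the last step moved toward in the fresh case, and otherwise the edge
  along which the walk has been running since.
\<close>

definition fresh :: "walk \<Rightarrow> bool" where
  "fresh w \<longleftrightarrow> depth (toward (last w)) (butlast w) = 0"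

definition base :: "walk \<Rightarrow> edge" where
  "base w = (if fresh w then toward (last w) else parallel (last w))"

text \<open>
  The local form of prudence: one may slide only along the base, and a run that has already begun
  must keep its direction.
\<close>

definition may_slide :: "walk \<Rightarrow> step \<Rightarrow> bool" where
  "may_slide w s \<longleftrightarrow> w \<noteq> [] \<and> parallel s = base w \<and> (fresh w \<or> s = last w)"

text \<open>
  The three conjuncts say: the endpoint lies on the base; the other two edges have visited points
  off the base, which block any slide along them starting at the base; and the endpoint is the only
  visited point of the base or, during a run, none of them lies ahead of it.
\<close>

definition front_invariant :: "walk \<Rightarrow> bool" where
  "front_invariant w \<longleftrightarrow>
     depth (base w) w = 0 \<and>
     (\<forall>e. e \<noteq> base w \<longrightarrow> (\<exists>p\<in>visited w. height e p = lowest e w \<and> lowest (base w) w < height (base w) p)) \<and>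
     (\<forall>p\<in>visited w. height (base w) p = lowest (base w) w \<longrightarrow>
        (if fresh w then p = endpoint w
         else height (toward (last w)) (endpoint w) \<le> height (toward (last w)) p))"

lemma visited_ray_iff:
  "(\<exists>k\<ge>1. endpoint w + scale k (vec s) \<in> visited w) \<longleftrightarrow>
     (\<exists>p\<in>visited w. height (parallel s) p = height (parallel s) (endpoint w) \<and>
        height (toward s) p < height (toward s) (endpoint w))" (is "?l \<longleftrightarrow> ?r")
proof
  assume ?l
  then obtain k where "k \<ge> 1" "endpoint w + scale k (vec s) \<in> visited w" by blast
  then show ?r
    using directions_distinct[of s]
    by (intro bexI[of _ "endpoint w + scale k (vec s)"]) (auto simp: height_ray)
next
  assume ?r
  then obtain p where p: "p \<in> visited w" "height (parallel s) p = height (parallel s) (endpoint w)"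
      "height (toward s) p < height (toward s) (endpoint w)" by blast
  define k where "k = height (toward s) (endpoint w) - height (toward s) p"
  have "p = endpoint w + scale k (vec s)"
    using p directions_distinct[of s]
    by (intro point_eqI_height[of "toward s" "parallel s"]) (auto simp: height_ray k_def)
  then show ?l
    using p by (intro exI[of _ k]) (auto simp: k_def)
qed

lemma heights_sum: "height (away s) p + height (toward s) p + height (parallel s) p = 0"
  by (cases s) auto

lemma opposite_step:
  assumes "parallel s = parallel r" "s \<noteq> r"
  shows "toward s = away r"
  using assms by (cases s; cases r; simp)

text \<open>
  Sliding along an edge other than the base starts at a corner of the base and aims at the visited
  point of that edge provided by the invariant. On the base itself, only a reversal of the current
  run aims at a visited point, namely the previous endpoint.
\<close>

lemma slide_iff:
  assumes "front_invariant w" "w \<noteq> []" and pos: "depth (toward s) w > 0"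
  shows "along_edge w s \<and> \<not> points_to_visited w s \<longleftrightarrow> may_slide w s"
proof -
  let ?c = "base w"
  have c0: "depth ?c w = 0"
    and other: "\<And>e. e \<noteq> ?c \<Longrightarrow> \<exists>p\<in>visited w. height e p = lowest e w \<and> lowest ?c w < height ?c p"
    and line: "\<And>p. p \<in> visited w \<Longrightarrow> height ?c p = lowest ?c w \<Longrightarrow>
        (if fresh w then p = endpoint w
         else height (toward (last w)) (endpoint w) \<le> height (toward (last w)) p)"
    using assms(1) by (auto simp: front_invariant_def)
  show ?thesis
  proof (cases "parallel s = ?c")
    case False
    have "\<not> (along_edge w s \<and> \<not> points_to_visited w s)"
    proof
      assume a: "along_edge w s \<and> \<not> points_to_visited w s"
      have "?c = away s"
        using False pos c0 edge_cases_step[of ?c s] by auto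
      with other[of "parallel s"] False obtain p where
        p: "p \<in> visited w" "height (parallel s) p = lowest (parallel s) w"
          "lowest (away s) w < height (away s) p" by auto
      have "height (parallel s) p = height (parallel s) (endpoint w)"
        using p a by (simp add: along_edge_iff height_endpoint)
      moreover have "height (away s) (endpoint w) < height (away s) p"
        using p c0 \<open>?c = away s\<close> by (simp add: height_endpoint)
      ultimately show False
        using a p(1) heights_sum[of s p] heights_sum[of s "endpoint w"]
        by (auto simp: points_to_visited_def visited_ray_iff)
    qed
    then show ?thesis
      using False by (simp add: may_slide_def)
  next
    case True
    have along: "along_edge w s"
      using True c0 pos by (simp add: along_edge_iff)
    have pt: "points_to_visited w s \<longleftrightarrow> \<not> (fresh w \<or> s = last w)"
    proof
      assume "points_to_visited w s"
      then obtain p where p: "p \<in> visited w" "height ?c p = height ?c (endpoint w)"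
        "height (toward s) p < height (toward s) (endpoint w)"
        unfolding points_to_visited_def visited_ray_iff True by blast
      with line[of p] c0 show "\<not> (fresh w \<or> s = last w)"
        by (auto simp: height_endpoint split: if_splits)
    next
      assume f: "\<not> (fresh w \<or> s = last w)"
      then have "parallel s = parallel (last w)"
        using True by (simp add: base_def)
      with f have opp: "toward s = away (last w)" by (intro opposite_step) auto
      obtain v where v: "w = v @ [last w]"
        using \<open>w \<noteq> []\<close> by (metis append_butlast_last_id)
      have "endpoint v \<in> visited w"
        by (subst v) (auto simp: visited_snoc endpoint_visited)
      moreover have "endpoint w = endpoint v + vec (last w)"
        by (subst v) simp
      ultimately show "points_to_visited w s"
        unfolding points_to_visited_def visited_ray_iff \<open>parallel s = parallel (last w)\<close> opp
        using directions_distinct[of "last w"]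
        by (auto simp: height_step intro!: bexI[of _ "endpoint v"])
    qed
    show ?thesis
      using along pt True \<open>w \<noteq> []\<close> by (auto simp: may_slide_def)
  qed
qed

text \<open>
  Whatever the walk was before, the new base lies beyond all points visited so far, in particular
  beyond the points that realize the two other edges.
\<close>

lemma front_invariant_inflate:
  assumes "depth (toward s) w = 0"
  shows "front_invariant (w @ [s])"
proof -
  have fresh: "fresh (w @ [s])" "base (w @ [s]) = toward s"
    using assms by (simp_all add: fresh_def base_def)
  let ?q = "toward s"
  have low: "lowest ?q (w @ [s]) = lowest ?q w - 1"
    using directions_distinct[of s] assms
    by (simp add: lowest_snoc height_step height_endpoint)
  have lowe: "lowest e (w @ [s]) = lowest e w" if "e \<noteq> ?q" for e
    using that by (simp add: lowest_snoc height_step height_endpoint)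
  have "depth ?q (w @ [s]) = 0"
    using assms directions_distinct[of s] by (simp add: depth_snoc)
  moreover have "\<exists>p\<in>visited (w @ [s]). height e p = lowest e (w @ [s]) \<and>
      lowest ?q (w @ [s]) < height ?q p" if "e \<noteq> ?q" for e
  proof -
    obtain p where p: "p \<in> visited w" "height e p = lowest e w"
      by (rule lowest_attained)
    then show ?thesis
      using lowest_le[OF p(1), of ?q] that
      by (intro bexI[of _ p]) (auto simp: low lowe visited_snoc)
  qed
  moreover have "p = endpoint (w @ [s])"
    if "p \<in> visited (w @ [s])" "height ?q p = lowest ?q (w @ [s])" for p
    using that lowest_le[of p w ?q] by (auto simp: low visited_snoc)
  ultimately show ?thesis
    unfolding front_invariant_def fresh by (simp add: fresh)
qed

lemma front_invariant_slide:
  assumes inv: "front_invariant w" and slide: "may_slide w s" and pos: "depth (toward s) w > 0"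
  shows "front_invariant (w @ [s])"
proof -
  let ?c = "parallel s"
  have c: "base w = ?c" "w \<noteq> []" "fresh w \<or> s = last w"
    using slide by (auto simp: may_slide_def)
  have fresh: "\<not> fresh (w @ [s])" "base (w @ [s]) = ?c"
    using pos by (simp_all add: fresh_def base_def)
  have c0: "depth ?c w = 0"
    and other: "\<And>e. e \<noteq> ?c \<Longrightarrow> \<exists>p\<in>visited w. height e p = lowest e w \<and> lowest ?c w < height ?c p"
    and line: "\<And>p. p \<in> visited w \<Longrightarrow> height ?c p = lowest ?c w \<Longrightarrow>
        (if fresh w then p = endpoint w
         else height (toward (last w)) (endpoint w) \<le> height (toward (last w)) p)"
    using inv by (auto simp: front_invariant_def c)
  have low: "lowest e (w @ [s]) = lowest e w" for e
    using pos by (auto simp: lowest_snoc height_step height_endpoint of_bool_def)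
  have "depth ?c (w @ [s]) = 0"
    using c0 directions_distinct[of s] by (auto simp: depth_snoc)
  moreover have "\<exists>p\<in>visited (w @ [s]). height e p = lowest e (w @ [s]) \<and>
      lowest ?c (w @ [s]) < height ?c p" if "e \<noteq> ?c" for e
    using other[OF that] by (auto simp: low visited_snoc)
  moreover have "height (toward s) (endpoint (w @ [s])) \<le> height (toward s) p"
    if "p \<in> visited (w @ [s])" "height ?c p = lowest ?c (w @ [s])" for p
    using that line[of p] c directions_distinct[of s]
    by (auto simp: low visited_snoc height_step split: if_splits)
  ultimately show ?thesis
    unfolding front_invariant_def fresh by (simp add: fresh)
qed

lemma prudent_front_invariant: "prudent w \<Longrightarrow> w \<noteq> [] \<Longrightarrow> front_invariant w"
proof (induction w rule: rev_induct)
  case (snoc s w)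
  show ?case
  proof (cases "depth (toward s) w = 0")
    case False
    with snoc have "w \<noteq> []" by auto
    with False snoc show ?thesis
      using slide_iff[of w s] by (auto simp: prudent_snoc inflates_iff intro: front_invariant_slide)
  qed (rule front_invariant_inflate)
qed simp

lemma prudent_snoc_iff:
  "prudent (w @ [s]) \<longleftrightarrow> prudent w \<and> (depth (toward s) w = 0 \<or> may_slide w s)"
proof (cases "depth (toward s) w = 0")
  case False
  then have "w \<noteq> []" by auto
  with False show ?thesis
    using slide_iff[of w s] prudent_front_invariant[of w]
    by (auto simp: prudent_snoc inflates_iff)
qed (simp add: prudent_snoc inflates_iff)

section \<open>Symmetries\<close>

text \<open>
  The inverse of the pair \<open>(away, toward)\<close>; on two equal edges its value is arbitrary.
\<close>

fun heading :: "edge \<Rightarrow> edge \<Rightarrow> step" where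
  "heading Left Right = E"
| "heading Bottom Right = NE"
| "heading Bottom Left = NW"
| "heading Right Left = W"
| "heading Right Bottom = SW"
| "heading Left Bottom = SE"
| "heading _ _ = E"

definition permute_step :: "(edge \<Rightarrow> edge) \<Rightarrow> step \<Rightarrow> step" where
  "permute_step \<pi> s = heading (\<pi> (away s)) (\<pi> (toward s))"

lemma heading_directions:
  assumes "e \<noteq> e'"
  shows "away (heading e e') = e" "toward (heading e e') = e'"
  using assms by (cases e; cases e'; simp)+

lemma permute_step_directions:
  assumes "inj \<pi>"
  shows "away (permute_step \<pi> s) = \<pi> (away s)"
    and "toward (permute_step \<pi> s) = \<pi> (toward s)"
    and "parallel (permute_step \<pi> s) = \<pi> (parallel s)"
proof -
  have neq: "\<pi> (away s) \<noteq> \<pi> (toward s)"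
    using assms directions_distinct[of s] by (simp add: inj_eq)
  then show 1: "away (permute_step \<pi> s) = \<pi> (away s)" "toward (permute_step \<pi> s) = \<pi> (toward s)"
    by (simp_all add: permute_step_def heading_directions)
  show "parallel (permute_step \<pi> s) = \<pi> (parallel s)"
    using edge_cases_step[of "\<pi> (parallel s)" "permute_step \<pi> s"] directions_distinct[of s]
    unfolding 1 inj_eq[OF assms] by auto
qed

lemma step_eqI: "away s = away r \<Longrightarrow> toward s = toward r \<Longrightarrow> s = r"
  by (cases s; cases r; simp)

lemma permute_step_eq_iff:
  assumes "inj \<pi>"
  shows "permute_step \<pi> s = permute_step \<pi> r \<longleftrightarrow> s = r"
proof
  assume eq: "permute_step \<pi> s = permute_step \<pi> r"
  show "s = r"
    using arg_cong[OF eq, of away] arg_cong[OF eq, of toward]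
    unfolding permute_step_directions[OF assms] inj_eq[OF assms] by (rule step_eqI)
qed simp

text \<open>
  All notions below are expressed through depths and through the edge relations of the steps, so
  the equivariance of the depth carries over to them.
\<close>

lemma depth_permute:
  assumes "inj \<pi>"
  shows "depth (\<pi> e) (map (permute_step \<pi>) w) = depth e w"
  by (induction w rule: rev_induct)
     (use assms in \<open>auto simp: depth_snoc permute_step_directions inj_eq\<close>)

lemma fresh_permute:
  assumes "inj \<pi>" "w \<noteq> []"
  shows "fresh (map (permute_step \<pi>) w) = fresh w"
  using assms by (simp add: fresh_def last_map map_butlast[symmetric] permute_step_directions depth_permute)

lemma base_permute:
  assumes "inj \<pi>" "w \<noteq> []"
  shows "base (map (permute_step \<pi>) w) = \<pi> (base w)"
  using assms by (simp add: base_def last_map fresh_permute permute_step_directions)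

lemma prudent_permute:
  assumes "inj \<pi>"
  shows "prudent (map (permute_step \<pi>) w) = prudent w"
proof (induction w rule: rev_induct)
  case (snoc s w)
  have "may_slide (map (permute_step \<pi>) w) (permute_step \<pi> s) = may_slide w s"
    using assms by (cases "w = []")
      (auto simp: may_slide_def base_permute fresh_permute last_map permute_step_directions
        permute_step_eq_iff inj_eq)
  with snoc show ?case
    using assms by (simp add: prudent_snoc_iff permute_step_directions depth_permute)
qed simp

lemma permute_involution:
  assumes "\<And>e. \<pi> (\<pi> e) = e"
  shows "map (permute_step \<pi>) (map (permute_step \<pi>) w) = w"
proof -
  have "inj \<pi>" by (metis assms injI)
  then have "permute_step \<pi> (permute_step \<pi> s) = s" for s
    by (intro step_eqI) (simp_all add: permute_step_directions assms)
  then show ?thesis by (simp add: comp_def)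
qed

section \<open>Recursive description of the walks\<close>

definition prudent_walks :: "nat \<Rightarrow> walk set" where
  "prudent_walks n = {w. prudent w \<and> length w = n}"

text \<open>
  Walks whose base is the right edge split according to their last step: they have just inflated
  this edge, or they are sliding along it. A sliding step determines the base.
\<close>

definition inflated :: "nat \<Rightarrow> walk set" where
  "inflated n = {w \<in> prudent_walks n. w \<noteq> [] \<and> fresh w \<and> base w = Right}"

definition sliding :: "step \<Rightarrow> nat \<Rightarrow> walk set" where
  "sliding s n = {w \<in> prudent_walks n. w \<noteq> [] \<and> \<not> fresh w \<and> last w = s}"

definition based :: "edge \<Rightarrow> nat \<Rightarrow> walk set" where
  "based e n = {w \<in> prudent_walks n. w \<noteq> [] \<and> base w = e}"

lemma finite_prudent_walks [simp]: "finite (prudent_walks n)"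
  using finite_walks_length[of n prudent] by (simp add: prudent_walks_def conj_commute)

lemma finite_classes [simp]:
  "finite (inflated n)" "finite (sliding s n)" "finite (based e n)"
  by (simp_all add: inflated_def sliding_def based_def)

lemma classes_0 [simp]: "inflated 0 = {}" "sliding s 0 = {}" "based e 0 = {}"
  by (auto simp: inflated_def sliding_def based_def prudent_walks_def)

lemma prudent_walks_0: "prudent_walks 0 = {[]}"
  by (auto simp: prudent_walks_def)

lemma walks_right_eq: "walks_right n = {w \<in> prudent_walks n. depth Right w = 0}"
  by (auto simp: walks_right_def prudent_walks_def edges_of_box endpoint_in_edge_iff)

lemma finite_walks_right [simp]: "finite (walks_right n)"
  by (simp add: walks_right_eq)

lemma snoc_cases_length:
  assumes "length w = Suc n"
  obtains v s where "w = v @ [s]" "length v = n"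
  using assms by (cases w rule: rev_cases) auto

lemma inflated_Suc:
  "inflated (Suc n) = (\<lambda>w. w @ [E]) ` walks_right n \<union> (\<lambda>w. w @ [NE]) ` walks_right n"
proof (intro set_eqI iffI)
  fix w assume w: "w \<in> inflated (Suc n)"
  then obtain v s where v: "w = v @ [s]" "length v = n"
    by (auto simp: inflated_def prudent_walks_def elim: snoc_cases_length)
  with w have s: "toward s = Right" "prudent v" "depth Right v = 0"
    by (auto simp: inflated_def prudent_walks_def fresh_def base_def prudent_snoc_iff split: if_splits)
  have "s = E \<or> s = NE"
    using s(1) by (cases s) auto
  then show "w \<in> (\<lambda>w. w @ [E]) ` walks_right n \<union> (\<lambda>w. w @ [NE]) ` walks_right n"
    using v s by (auto simp: walks_right_eq prudent_walks_def)
next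
  fix w assume "w \<in> (\<lambda>w. w @ [E]) ` walks_right n \<union> (\<lambda>w. w @ [NE]) ` walks_right n"
  then show "w \<in> inflated (Suc n)"
    by (auto simp: inflated_def walks_right_eq prudent_walks_def fresh_def base_def prudent_snoc_iff)
qed

lemma based_Right: "based Right n = inflated n \<union> sliding NW n \<union> sliding SE n"
proof -
  have "parallel s = Right \<longleftrightarrow> s = NW \<or> s = SE" for s
    by (cases s) auto
  then show ?thesis
    by (auto simp: based_def inflated_def sliding_def base_def)
qed

lemma base_depth: "w \<in> based e n \<Longrightarrow> depth e w = 0"
  using prudent_front_invariant[of w] by (auto simp: based_def prudent_walks_def front_invariant_def)

text \<open>
  A run toward North-West along the right edge can go on until it reaches the N corner, where the
  left depth is 0; the next NW step would inflate the left edge.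
\<close>

lemma sliding_Suc:
  "sliding NW (Suc n) = (\<lambda>w. w @ [NW]) ` {w \<in> inflated n \<union> sliding NW n. depth Left w > 0}"
proof (intro set_eqI iffI)
  fix w assume w: "w \<in> sliding NW (Suc n)"
  then obtain v s where v: "w = v @ [s]" "length v = n"
    by (auto simp: sliding_def prudent_walks_def elim: snoc_cases_length)
  with w show "w \<in> (\<lambda>w. w @ [NW]) ` {w \<in> inflated n \<union> sliding NW n. depth Left w > 0}"
    by (auto simp: sliding_def inflated_def prudent_walks_def fresh_def prudent_snoc_iff may_slide_def)
next
  fix w assume "w \<in> (\<lambda>w. w @ [NW]) ` {w \<in> inflated n \<union> sliding NW n. depth Left w > 0}"
  then show "w \<in> sliding NW (Suc n)"
    by (auto simp: sliding_def inflated_def prudent_walks_def prudent_snoc_iff may_slide_def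
      base_def) (auto simp: fresh_def)
qed

section \<open>Weighted counts\<close>

text \<open>
  For walks on the right edge, the depths with respect to the bottom and the left edge are the
  distances to the SE and to the N corner. The weights are taken in an arbitrary ring, which
  makes it possible to substitute series later on.
\<close>

definition weight_sum :: "walk set \<Rightarrow> 'a::comm_ring_1 \<Rightarrow> 'a \<Rightarrow> 'a" where
  "weight_sum V a b = (\<Sum>w\<in>V. a ^ depth Bottom w * b ^ depth Left w)"

lemma weight_sum_empty [simp]: "weight_sum {} a b = 0"
  by (simp add: weight_sum_def)

lemma weight_sum_Un:
  "finite V \<Longrightarrow> finite V' \<Longrightarrow> V \<inter> V' = {} \<Longrightarrow>
     weight_sum (V \<union> V') a b = weight_sum V a b + weight_sum V' a b"
  by (simp add: weight_sum_def sum.union_disjoint)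

lemma weight_sum_inflated_Suc:
  "weight_sum (inflated (Suc n)) a b = (a + b) * weight_sum (walks_right n) a b"
proof -
  have "weight_sum ((\<lambda>w. w @ [E]) ` walks_right n) a b = b * weight_sum (walks_right n) a b"
    unfolding weight_sum_def
    by (subst sum.reindex) (auto simp: inj_on_def depth_snoc sum_distrib_left mult_ac)
  moreover have "weight_sum ((\<lambda>w. w @ [NE]) ` walks_right n) a b = a * weight_sum (walks_right n) a b"
    unfolding weight_sum_def
    by (subst sum.reindex) (auto simp: inj_on_def depth_snoc sum_distrib_left mult_ac)
  ultimately show ?thesis
    unfolding inflated_Suc by (subst weight_sum_Un) (auto simp: algebra_simps)
qed

lemma weight_sum_diff_0:
  assumes "finite V"
  shows "weight_sum V a b - weight_sum V a 0 = weight_sum {w \<in> V. depth Left w > 0} a b"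
proof -
  have "weight_sum V a b - weight_sum V a 0
      = (\<Sum>w\<in>V. a ^ depth Bottom w * (b ^ depth Left w - 0 ^ depth Left w))"
    by (simp add: weight_sum_def sum_subtractf right_diff_distrib)
  also have "\<dots> = (\<Sum>w | w \<in> V \<and> depth Left w > 0. a ^ depth Bottom w * (b ^ depth Left w - 0 ^ depth Left w))"
    using assms by (intro sum.mono_neutral_right) auto
  also have "\<dots> = weight_sum {w \<in> V. depth Left w > 0} a b"
    unfolding weight_sum_def by (intro sum.cong) (auto simp: zero_power)
  finally show ?thesis .
qed

text \<open>
  The subtraction of the value at 0 removes the walks that end at the N corner, as these cannot
  be extended; multiplication by \<open>b\<close> replaces the division by \<open>b\<close>, which need not exist.
\<close>

lemma weight_sum_sliding_Suc:
  "b * weight_sum (sliding NW (Suc n)) a b =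
     a * (weight_sum (inflated n \<union> sliding NW n) a b - weight_sum (inflated n \<union> sliding NW n) a 0)"
proof -
  have "b * weight_sum (sliding NW (Suc n)) a b =
      a * weight_sum {w \<in> inflated n \<union> sliding NW n. depth Left w > 0} a b"
    unfolding sliding_Suc weight_sum_def
  proof (subst sum.reindex, goal_cases)
    case 2
    show ?case
      unfolding sum_distrib_left
    proof (intro sum.cong refl)
      fix w assume "w \<in> {w \<in> inflated n \<union> sliding NW n. depth Left w > 0}"
      then obtain l where "depth Left w = Suc l"
        by (auto simp: gr0_conv_Suc)
      then show "b * ((\<lambda>w. a ^ depth Bottom w * b ^ depth Left w) \<circ> (\<lambda>w. w @ [NW])) w =
          a * (a ^ depth Bottom w * b ^ depth Left w)"
        by (simp add: depth_snoc mult_ac)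
    qed
  qed (auto simp: inj_on_def)
  then show ?thesis
    by (subst weight_sum_diff_0) auto
qed

definition swap_edges :: "edge \<Rightarrow> edge \<Rightarrow> edge \<Rightarrow> edge" where
  "swap_edges e f = id(e := f, f := e)"

lemma swap_edges_apply [simp]:
  "swap_edges e f e = f" "swap_edges e f f = e"
  "g \<noteq> e \<Longrightarrow> g \<noteq> f \<Longrightarrow> swap_edges e f g = g"
  by (simp_all add: swap_edges_def)

lemma swap_edges_involution: "swap_edges e f (swap_edges e f g) = g"
  by (simp add: swap_edges_def)

lemma inj_swap_edges: "inj (swap_edges e f)"
  by (metis swap_edges_involution injI)

lemma sum_swap_edges:
  assumes "\<And>w. map (permute_step (swap_edges e f)) w \<in> V' \<longleftrightarrow> w \<in> V"
  shows "(\<Sum>w\<in>V'. g (\<lambda>c. depth c w)) = (\<Sum>w\<in>V. g (\<lambda>c. depth (swap_edges e f c) w))"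
proof -
  let ?m = "map (permute_step (swap_edges e f))"
  have invol: "?m (?m w) = w" for w
    by (rule permute_involution) (rule swap_edges_involution)
  have depth: "depth c (?m w) = depth (swap_edges e f c) w" for c w
    by (metis depth_permute inj_swap_edges swap_edges_involution)
  show ?thesis
  proof (rule sum.reindex_bij_witness[where i = ?m and j = ?m])
    show "g (\<lambda>c. depth (swap_edges e f c) (?m w)) = g (\<lambda>c. depth c w)" for w
      by (simp only: depth[symmetric] invol)
  qed (use assms invol in metis)+
qed

lemma prudent_walks_permute:
  "inj \<pi> \<Longrightarrow> map (permute_step \<pi>) w \<in> prudent_walks n \<longleftrightarrow> w \<in> prudent_walks n"
  by (simp add: prudent_walks_def prudent_permute)

lemma based_permute:
  "inj \<pi> \<Longrightarrow> map (permute_step \<pi>) w \<in> based (\<pi> e) n \<longleftrightarrow> w \<in> based e n"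
  by (cases "w = []") (auto simp: based_def prudent_walks_permute base_permute inj_eq)

lemma inflated_permute:
  "inj \<pi> \<Longrightarrow> \<pi> Right = Right \<Longrightarrow> map (permute_step \<pi>) w \<in> inflated n \<longleftrightarrow> w \<in> inflated n"
  using inj_eq[of \<pi> "base w" Right]
  by (cases "w = []") (auto simp: inflated_def prudent_walks_permute base_permute fresh_permute)

lemma sliding_permute:
  "inj \<pi> \<Longrightarrow> map (permute_step \<pi>) w \<in> sliding (permute_step \<pi> s) n \<longleftrightarrow> w \<in> sliding s n"
  by (cases "w = []")
     (auto simp: sliding_def prudent_walks_permute fresh_permute last_map permute_step_eq_iff)

lemma weight_sum_inflated_commute: "weight_sum (inflated n) a b = weight_sum (inflated n) b a"
  unfolding weight_sum_def
  by (subst sum_swap_edges[where e = Bottom and f = Left and V = "inflated n"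
        and g = "\<lambda>d. a ^ d Bottom * b ^ d Left"])
     (simp_all add: inflated_permute inj_swap_edges mult.commute)

lemma weight_sum_sliding_SE: "weight_sum (sliding SE n) a b = weight_sum (sliding NW n) b a"
proof -
  have "SE = permute_step (swap_edges Bottom Left) NW"
    by (simp add: permute_step_def)
  then show ?thesis
    unfolding weight_sum_def
    by (subst sum_swap_edges[where e = Bottom and f = Left and V = "sliding NW n"
          and g = "\<lambda>d. a ^ d Bottom * b ^ d Left"])
       (use sliding_permute[OF inj_swap_edges, of Bottom Left _ NW n] in \<open>simp_all add: mult.commute\<close>)
qed

text \<open>
  The right edge is also reached by walks based on the left edge that end at the N corner. The
  reflection exchanging these two edges fixes that corner.
\<close>

lemma weight_sum_corner_N:
  "weight_sum {w \<in> based Left n. depth Right w = 0} a b = weight_sum (based Right n) a 0"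
proof -
  have "weight_sum {w \<in> based Left n. depth Right w = 0} a b =
      (\<Sum>w\<in>based Left n. if depth Right w = 0 then a ^ depth Bottom w * b ^ depth Left w else 0)"
    by (simp add: weight_sum_def sum.inter_filter)
  also have "\<dots> = (\<Sum>w\<in>based Right n. if depth Left w = 0 then a ^ depth Bottom w * b ^ depth Right w else 0)"
    by (subst sum_swap_edges[where e = Left and f = Right and V = "based Right n"
          and g = "\<lambda>d. if d Right = 0 then a ^ d Bottom * b ^ d Left else 0"])
       (use based_permute[OF inj_swap_edges, of Left Right _ Right n] in \<open>simp_all cong: if_cong\<close>)
  also have "\<dots> = weight_sum (based Right n) a 0"
    unfolding weight_sum_def by (intro sum.cong) (auto simp: base_depth zero_power)
  finally show ?thesis .
qed

lemma weight_sum_corner_SE: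
  "weight_sum {w \<in> based Bottom n. depth Right w = 0} a b = weight_sum (based Right n) 0 b"
proof -
  have "weight_sum {w \<in> based Bottom n. depth Right w = 0} a b =
      (\<Sum>w\<in>based Bottom n. if depth Right w = 0 then a ^ depth Bottom w * b ^ depth Left w else 0)"
    by (simp add: weight_sum_def sum.inter_filter)
  also have "\<dots> = (\<Sum>w\<in>based Right n. if depth Bottom w = 0 then a ^ depth Right w * b ^ depth Left w else 0)"
    by (subst sum_swap_edges[where e = Bottom and f = Right and V = "based Right n"
          and g = "\<lambda>d. if d Right = 0 then a ^ d Bottom * b ^ d Left else 0"])
       (use based_permute[OF inj_swap_edges, of Bottom Right _ Right n] in \<open>simp_all cong: if_cong\<close>)
  also have "\<dots> = weight_sum (based Right n) 0 b"
    unfolding weight_sum_def by (intro sum.cong) (auto simp: base_depth zero_power)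
  finally show ?thesis .
qed

lemma prudent_walks_Suc:
  "prudent_walks (Suc n) = based Right (Suc n) \<union> based Left (Suc n) \<union> based Bottom (Suc n)"
  by (auto simp: based_def prudent_walks_def) (metis edge.exhaust)

lemma weight_sum_walks_right_0: "weight_sum (walks_right 0) a b = 1"
proof -
  have "walks_right 0 = {[]}"
    by (auto simp: walks_right_eq prudent_walks_0)
  then show ?thesis
    by (simp add: weight_sum_def)
qed

lemma weight_sum_walks_right_Suc:
  "weight_sum (walks_right (Suc n)) a b = weight_sum (based Right (Suc n)) a b
     + weight_sum (based Right (Suc n)) a 0 + weight_sum (based Right (Suc n)) 0 b"
proof -
  have "walks_right (Suc n) = based Right (Suc n) \<union> {w \<in> based Left (Suc n). depth Right w = 0}
      \<union> {w \<in> based Bottom (Suc n). depth Right w = 0}"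
    unfolding walks_right_eq prudent_walks_Suc using base_depth by auto
  also have "weight_sum \<dots> a b = weight_sum (based Right (Suc n)) a b
      + weight_sum {w \<in> based Left (Suc n). depth Right w = 0} a b
      + weight_sum {w \<in> based Bottom (Suc n). depth Right w = 0} a b"
    by (subst weight_sum_Un, simp, simp, force simp: based_def)+ (rule refl)
  finally show ?thesis
    by (simp only: weight_sum_corner_N weight_sum_corner_SE)
qed

text \<open>
  The size of the box is the sum of the three depths, which is invariant under all permutations
  of the edges, and the depth with respect to the base is 0.
\<close>

lemma sum_size_prudent_Suc:
  fixes a :: "'a::comm_ring_1"
  shows "(\<Sum>w\<in>prudent_walks (Suc n). a ^ box_size w) = 3 * weight_sum (based Right (Suc n)) a a"
proof -
  let ?f = "\<lambda>d. a ^ (d Bottom + d Left + d Right) :: 'a"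
  have right: "(\<Sum>w\<in>based Right (Suc n). a ^ box_size w) = weight_sum (based Right (Suc n)) a a"
    unfolding weight_sum_def by (intro sum.cong) (auto simp: box_coords(2) base_depth power_add)
  have swap: "(\<Sum>w\<in>based e (Suc n). a ^ box_size w) = (\<Sum>w\<in>based Right (Suc n). a ^ box_size w)" for e
    unfolding box_coords(2)
    by (subst sum_swap_edges[where e = e and f = Right and V = "based Right (Suc n)" and g = ?f])
       (use based_permute[OF inj_swap_edges, of e Right _ Right "Suc n"] in
         \<open>cases e; simp add: add_ac\<close>)+
  have "(\<Sum>w\<in>prudent_walks (Suc n). a ^ box_size w) =
      (\<Sum>w\<in>based Right (Suc n). a ^ box_size w) + (\<Sum>w\<in>based Left (Suc n). a ^ box_size w)
      + (\<Sum>w\<in>based Bottom (Suc n). a ^ box_size w)"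
    unfolding prudent_walks_Suc
    by (subst sum.union_disjoint, simp, simp, force simp: based_def)+ (rule refl)
  then show ?thesis
    unfolding swap[of Left] swap[of Bottom] right by simp
qed

lemma weight_sum_based_Right:
  "weight_sum (based Right n) a b =
     weight_sum (inflated n) a b + weight_sum (sliding NW n) a b + weight_sum (sliding NW n) b a"
proof -
  have "weight_sum (based Right n) a b =
     weight_sum (inflated n) a b + weight_sum (sliding NW n) a b + weight_sum (sliding SE n) a b"
    unfolding based_Right
    by (subst weight_sum_Un, simp, simp, force simp: inflated_def sliding_def)+ (rule refl)
  then show ?thesis
    by (simp add: weight_sum_sliding_SE)
qed

lemma weight_sum_sliding_0: "weight_sum (sliding NW n) 0 b = 0"
proof (cases n)
  case (Suc m)
  have "depth Bottom w > 0" if "w \<in> sliding NW n" for w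
    using that unfolding Suc sliding_Suc by (auto simp: depth_snoc)
  then show ?thesis
    by (auto simp: weight_sum_def zero_power intro!: sum.neutral)
qed simp

section \<open>Passing to power series\<close>

lemma eval2_monom: "eval2 (monom (monom 1 i) j) a b = a ^ i * b ^ j"
  by (simp add: eval2_def map_poly_monom poly_monom)

lemma map_poly_add_hom:
  assumes "f 0 = 0" "\<And>x y. f (x + y) = f x + f y"
  shows "map_poly f (p + q) = map_poly f p + map_poly f q"
  by (rule poly_eqI) (simp add: coeff_map_poly assms)

lemma eval2_add: "eval2 (p + q) a b = eval2 p a b + eval2 q a b"
  unfolding eval2_def by (subst map_poly_add_hom) (simp_all add: map_poly_add_hom)

lemma eval2_sum: "eval2 (\<Sum>i\<in>I. p i) a b = (\<Sum>i\<in>I. eval2 (p i) a b)"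
  by (induction I rule: infinite_finite_induct) (simp_all add: eval2_add, simp_all add: eval2_def)

lemma dists_right:
  assumes "depth Right w = 0"
  shows "dist_SE w = depth Bottom w" "dist_N w = depth Left w"
  using assms height_endpoint[of Left w] height_endpoint[of Right w] height_endpoint[of Bottom w]
  by (auto simp: dist_SE_def dist_N_def corner_SE_def corner_N_def box_coords lattice_dist_def
    Let_def scale_def)

lemma eval2_R_gf: "eval2 (R_gf $ n) a b = weight_sum (walks_right n) a b"
  unfolding R_gf_def weight_sum_def fps_nth_Abs_fps eval2_sum eval2_monom
  by (intro sum.cong) (auto simp: walks_right_eq dists_right)

lemma fps_X_power_dvd:
  fixes f :: "'a::comm_ring_1 fps"
  assumes "\<And>m. m < N \<Longrightarrow> f $ m = 0"
  shows "fps_X ^ N dvd f"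
proof
  show "f = fps_X ^ N * fps_shift N f"
    by (rule fps_ext) (use assms in \<open>auto simp: fps_X_power_mult_nth\<close>)
qed

lemma sums_fpsI:
  fixes f :: "nat \<Rightarrow> 'a::comm_ring_1 fps"
  assumes "\<And>N. fps_X ^ N dvd s - (\<Sum>n<N. f n)"
  shows "f sums s"
  unfolding sums_def
proof (rule tendsto_fpsI)
  fix m
  have "(\<Sum>n<N. f n) $ m = s $ m" if "m < N" for N
  proof -
    obtain h where "s - (\<Sum>n<N. f n) = fps_X ^ N * h"
      using assms[of N] by (auto elim: dvdE)
    then have "(s - (\<Sum>n<N. f n)) $ m = 0"
      using that by (simp add: fps_X_power_mult_nth)
    then show ?thesis by simp
  qed
  then show "\<forall>\<^sub>F N in sequentially. (\<Sum>n<N. f n) $ m = s $ m"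
    by (auto intro: eventually_mono[OF eventually_gt_at_top])
qed

definition series :: "(nat \<Rightarrow> 'a::comm_ring_1 fps) \<Rightarrow> 'a fps" where
  "series g = (\<Sum>n. fps_X ^ n * g n)"

text \<open>
  Congruences modulo the powers of the indeterminate characterize the sum of a \<open>t\<close>-adically
  convergent series, and are preserved by ring operations. This replaces arguments about limits.
\<close>

lemma series_eqI:
  assumes "\<And>N. fps_X ^ N dvd s - (\<Sum>n<N. fps_X ^ n * g n)"
  shows "series g = s"
  unfolding series_def using sums_fpsI[OF assms] by (rule sums_unique[symmetric])

lemma series_remainder: "fps_X ^ N dvd series g - (\<Sum>n<N. fps_X ^ n * g n)"
proof -
  define s where "s = Abs_fps (\<lambda>m. \<Sum>n\<le>m. (fps_X ^ n * g n) $ m)"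
  have *: "fps_X ^ N dvd s - (\<Sum>n<N. fps_X ^ n * g n)" for N
  proof (rule fps_X_power_dvd)
    fix m assume "m < N"
    then have "(\<Sum>n<N. (fps_X ^ n * g n) $ m) = (\<Sum>n\<le>m. (fps_X ^ n * g n) $ m)"
      by (intro sum.mono_neutral_right) (auto simp: fps_X_power_mult_nth)
    then show "(s - (\<Sum>n<N. fps_X ^ n * g n)) $ m = 0"
      by (simp add: s_def fps_sum_nth)
  qed
  then have "series g = s" by (rule series_eqI)
  with * show ?thesis by simp
qed

lemma series_add: "series (\<lambda>n. f n + g n) = series f + series g"
proof (rule series_eqI)
  fix N
  have "series f + series g - (\<Sum>n<N. fps_X ^ n * (f n + g n)) =
      (series f - (\<Sum>n<N. fps_X ^ n * f n)) + (series g - (\<Sum>n<N. fps_X ^ n * g n))"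
    by (simp add: distrib_left sum.distrib)
  then show "fps_X ^ N dvd series f + series g - (\<Sum>n<N. fps_X ^ n * (f n + g n))"
    by (simp only: dvd_add series_remainder)
qed

lemma series_mult: "series (\<lambda>n. c * g n) = c * series g"
proof (rule series_eqI)
  fix N
  have "c * series g - (\<Sum>n<N. fps_X ^ n * (c * g n)) = c * (series g - (\<Sum>n<N. fps_X ^ n * g n))"
    by (simp add: right_diff_distrib sum_distrib_left mult_ac)
  then show "fps_X ^ N dvd c * series g - (\<Sum>n<N. fps_X ^ n * (c * g n))"
    by (simp add: series_remainder)
qed

lemma series_diff: "series (\<lambda>n. f n - g n) = series f - series g"
  using series_add[of "\<lambda>n. f n - g n" g] by simp

lemma series_Suc: "series g = g 0 + fps_X * series (\<lambda>n. g (Suc n))"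
proof (rule series_eqI)
  fix N
  show "fps_X ^ N dvd g 0 + fps_X * series (\<lambda>n. g (Suc n)) - (\<Sum>n<N. fps_X ^ n * g n)"
  proof (cases N)
    case (Suc M)
    have "g 0 + fps_X * series (\<lambda>n. g (Suc n)) - (\<Sum>n<N. fps_X ^ n * g n) =
        fps_X * (series (\<lambda>n. g (Suc n)) - (\<Sum>n<M. fps_X ^ n * g (Suc n)))"
      unfolding Suc sum.lessThan_Suc_shift by (simp add: right_diff_distrib sum_distrib_left mult_ac)
    then show ?thesis
      unfolding Suc power_Suc by (simp add: series_remainder mult_dvd_mono)
  qed simp
qed

definition gf :: "(nat \<Rightarrow> walk set) \<Rightarrow> 'a::comm_ring_1 fps \<Rightarrow> 'a fps \<Rightarrow> 'a fps" where
  "gf V a b = series (\<lambda>n. weight_sum (V n) a b)"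

lemma gf_inflated: "gf inflated a b = fps_X * (a + b) * gf walks_right a b"
  unfolding gf_def
  by (subst series_Suc) (simp add: weight_sum_inflated_Suc series_mult mult.assoc)

lemma gf_sliding:
  "b * gf (sliding NW) a b = fps_X * a * (gf inflated a b + gf (sliding NW) a b
     - (gf inflated a 0 + gf (sliding NW) a 0))"
proof -
  have split: "weight_sum (inflated n \<union> sliding NW n) a c =
      weight_sum (inflated n) a c + weight_sum (sliding NW n) a c" for n c
    by (subst weight_sum_Un) (auto simp: inflated_def sliding_def)
  have "b * gf (sliding NW) a b = fps_X * series (\<lambda>n. b * weight_sum (sliding NW (Suc n)) a b)"
    unfolding gf_def by (subst series_Suc) (simp add: series_mult mult_ac)
  also have "\<dots> = fps_X * (a * (series (\<lambda>n. (weight_sum (inflated n) a b + weight_sum (sliding NW n) a b)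
      - (weight_sum (inflated n) a 0 + weight_sum (sliding NW n) a 0))))"
    unfolding weight_sum_sliding_Suc split series_mult ..
  also have "\<dots> = fps_X * a * (gf inflated a b + gf (sliding NW) a b
     - (gf inflated a 0 + gf (sliding NW) a 0))"
    by (simp add: gf_def series_add series_diff mult.assoc)
  finally show ?thesis .
qed

text \<open>
  Walks based on the right edge and ending at the N corner: the weight 0 for the left depth
  leaves only the walks for which this depth is 0.
\<close>

definition corner_gf :: "'a::comm_ring_1 fps \<Rightarrow> 'a fps" where
  "corner_gf a = gf (based Right) a 0"

lemma gf_based:
  "gf (based Right) a b = gf inflated a b + gf (sliding NW) a b + gf (sliding NW) b a"
  unfolding gf_def weight_sum_based_Right series_add ..

lemma corner_gf_eq: "corner_gf a = gf inflated a 0 + gf (sliding NW) a 0"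
  unfolding corner_gf_def gf_def weight_sum_based_Right weight_sum_sliding_0 by (simp add: series_add)

lemma corner_gf_SE: "gf (based Right) 0 b = corner_gf b"
  unfolding corner_gf_def gf_def weight_sum_based_Right
  by (simp add: weight_sum_inflated_commute[of _ 0] weight_sum_sliding_0)

text \<open>
  The constant 1 counts the empty walk, and the last two terms count the walks based on the left
  and on the bottom edge.
\<close>

lemma gf_walks_right:
  "gf walks_right a b = 1 + gf (based Right) a b + corner_gf a + corner_gf b"
proof -
  have "gf walks_right a b = 1 + fps_X * series (\<lambda>n. weight_sum (based Right (Suc n)) a b
     + weight_sum (based Right (Suc n)) a 0 + weight_sum (based Right (Suc n)) 0 b)"
    unfolding gf_def
    by (subst series_Suc) (simp add: weight_sum_walks_right_0 weight_sum_walks_right_Suc)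
  moreover have "gf (based Right) c d = fps_X * series (\<lambda>n. weight_sum (based Right (Suc n)) c d)"
    for c d :: "'a fps"
    unfolding gf_def by (subst series_Suc) simp
  ultimately show ?thesis
    unfolding corner_gf_SE[symmetric, of b] corner_gf_def[of a]
    by (simp add: series_add distrib_left add_ac)
qed

lemma subst2_R_gf: "subst2 R_gf a b = gf walks_right a b"
  by (simp add: subst2_def gf_def series_def eval2_R_gf)

text \<open>
  For \<open>b = t a\<close> the two occurrences of the sliding walks in \<open>gf_sliding\<close> cancel. Combinatorially,
  a walk ends at the N corner after an inflation at distance \<open>j\<close> from it followed by \<open>j\<close> steps NW,
  each of which trades a factor \<open>b\<close> for \<open>t a\<close>.
\<close>

lemma corner_gf_closed:
  fixes a :: "'a::idom fps"
  assumes "a \<noteq> 0"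
  shows "corner_gf a = fps_X * (1 + fps_X) * a * gf walks_right a (fps_X * a)"
proof -
  have "fps_X * a * gf (sliding NW) a (fps_X * a) = fps_X * a *
      (gf inflated a (fps_X * a) + gf (sliding NW) a (fps_X * a) - corner_gf a)"
    using gf_sliding[of "fps_X * a" a] by (simp add: corner_gf_eq)
  then have "corner_gf a = gf inflated a (fps_X * a)"
    using assms by simp
  then show ?thesis
    by (simp add: gf_inflated algebra_simps)
qed

section \<open>The functional equation\<close>

text \<open>
  The two equations for the sliding walks become linear after multiplication by the denominators
  \<open>b - t a\<close> and \<open>a - t b\<close>; what remains is elimination of the inflated and the sliding walks.
\<close>

lemma kernel_equation:
  fixes a b :: "'a::comm_ring_1 fps"
  defines "t \<equiv> fps_X"
  shows "((b - t * a) * (a - t * b) - t * (a + b) * (a * b * (1 - t ^ 2))) * gf walks_right a b =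
    (b - t * a) * (a - t * b) + (a - t * b) * (b - 2 * t * a) * corner_gf a
      + (b - t * a) * (a - 2 * t * b) * corner_gf b"
proof -
  define A where "A = gf inflated a b"
  define Y where "Y = gf (sliding NW) a b"
  define Z where "Z = gf (sliding NW) b a"
  define R where "R = gf walks_right a b"
  have "gf inflated b a = A"
    unfolding A_def gf_def by (subst weight_sum_inflated_commute) (rule refl)
  then have Z: "(a - t * b) * Z = t * b * (A - corner_gf b)"
    using gf_sliding[of a b] by (simp add: Z_def corner_gf_eq t_def algebra_simps)
  have Y: "(b - t * a) * Y = t * a * (A - corner_gf a)"
    using gf_sliding[of b a] by (simp add: A_def Y_def corner_gf_eq t_def algebra_simps)
  have A: "A = t * (a + b) * R"
    by (simp add: A_def R_def t_def gf_inflated)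
  have R: "R = 1 + A + Y + Z + corner_gf a + corner_gf b"
    by (simp add: R_def gf_walks_right gf_based A_def Y_def Z_def)
  have "(b - t * a) * (a - t * b) * R =
      (b - t * a) * (a - t * b) * (1 + A + corner_gf a + corner_gf b)
      + (a - t * b) * ((b - t * a) * Y) + (b - t * a) * ((a - t * b) * Z)"
    by (subst R) (simp add: algebra_simps)
  also have "\<dots> = (b - t * a) * (a - t * b) + (a - t * b) * (b - 2 * t * a) * corner_gf a
      + (b - t * a) * (a - 2 * t * b) * corner_gf b + a * b * (1 - t ^ 2) * A"
    unfolding Y Z by (simp add: algebra_simps power2_eq_square)
  finally show ?thesis
    unfolding R_def[symmetric] A by (simp add: algebra_simps)
qed

lemma recip_eqI:
  fixes f :: "'a::comm_ring_1 fps"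
  assumes "f $ 0 = 1" "f * g = 1"
  shows "recip f = g"
  using assms mult_recip[OF assms(1)] by (metis mult.assoc mult.commute mult.left_neutral)

text \<open>
  The pair of \<open>kernel_root y\<close> and \<open>kernel_root (t y)\<close> parametrizes the curve on which the kernel
  vanishes. The factor that distinguishes \<open>normalized_right\<close> from \<open>R(u(y), t u(y))\<close> gives the
  recursion below polynomial coefficients.
\<close>

definition kernel_root :: "'a::comm_ring_1 fps \<Rightarrow> 'a fps" where
  "kernel_root y = y * (1 - fps_X) * recip ((1 + fps_X * y) * (1 + fps_X ^ 2 * y))"

definition normalized_right :: "'a::comm_ring_1 fps \<Rightarrow> 'a fps" where
  "normalized_right y = recip ((1 + fps_X * y) * (1 + fps_X ^ 2 * y))
     * gf walks_right (kernel_root y) (fps_X * kernel_root y)"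

lemma one_minus_X_nonzero: "(1 :: 'a::comm_ring_1 fps) - fps_X \<noteq> 0" "(1 :: 'a fps) - fps_X ^ 2 \<noteq> 0"
proof -
  have "((1 :: 'a fps) - fps_X) $ 0 = 1" "((1 :: 'a fps) - fps_X ^ 2) $ 0 = 1"
    by simp_all
  then show "(1 :: 'a fps) - fps_X \<noteq> 0" "(1 :: 'a fps) - fps_X ^ 2 \<noteq> 0"
    by (metis fps_zero_nth zero_neq_one)+
qed

lemma corner_gf_kernel_root:
  fixes y :: "'a::idom fps"
  assumes "y \<noteq> 0"
  shows "corner_gf (kernel_root y) = fps_X * (1 - fps_X ^ 2) * y * normalized_right y"
proof -
  have "(1 + fps_X * y) * (1 + fps_X ^ 2 * y) * kernel_root y =
      y * (1 - fps_X) * ((1 + fps_X * y) * (1 + fps_X ^ 2 * y) * recip ((1 + fps_X * y) * (1 + fps_X ^ 2 * y)))"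
    by (simp only: kernel_root_def mult_ac)
  also have "\<dots> = y * (1 - fps_X)"
    by (subst mult_recip) simp_all
  finally have "kernel_root y \<noteq> 0"
    using assms one_minus_X_nonzero(1) by auto
  then show ?thesis
    by (subst corner_gf_closed)
       (simp_all add: normalized_right_def kernel_root_def power2_eq_square algebra_simps)
qed

text \<open>
  Up to a common factor \<open>s\<close>, the two kernel roots are \<open>1 + t^3 y\<close> and \<open>t (1 + t y)\<close>, so all the
  factors in \<open>kernel_equation\<close> are explicit. Once the unknown \<open>R(a,b)\<close> has dropped out, the nonzero
  factor \<open>s^2 t^2 y (1 - t^2)^2\<close> can be cancelled.
\<close>

lemma normalized_right_step:
  fixes y :: "'a::idom fps"
  assumes "y \<noteq> 0"
  defines "t \<equiv> fps_X" and "c \<equiv> 1 - 2 * fps_X ^ 2"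
  shows "(1 - t * y * c) * normalized_right y =
    1 + t ^ 2 * y * (c - t ^ 3 * y) * normalized_right (t * y)"
proof -
  define D1 D2 D3 where "D1 = 1 + t * y" and "D2 = 1 + t ^ 2 * y" and "D3 = 1 + t ^ 3 * y"
  define s where "s = y * (1 - t) * (recip (D1 * D2) * recip D3)"
  define a b where "a = kernel_root y" and "b = kernel_root (t * y)"
  have D0: "D1 $ 0 = 1" "D2 $ 0 = 1" "D3 $ 0 = 1"
    by (simp_all add: D1_def D2_def D3_def t_def)
  have inv: "D1 * D2 * recip (D1 * D2) = 1" "D3 * recip D3 = 1"
    using D0 by (auto intro!: mult_recip)
  have "s * D3 = y * (1 - t) * recip (D1 * D2) * (D3 * recip D3)"
    by (simp only: s_def mult_ac)
  then have a: "a = s * D3"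
    by (simp add: a_def kernel_root_def D1_def D2_def t_def inv)
  have "recip (D2 * D3) = D1 * (recip (D1 * D2) * recip D3)"
  proof (rule recip_eqI)
    have "D2 * D3 * (D1 * (recip (D1 * D2) * recip D3)) = (D1 * D2 * recip (D1 * D2)) * (D3 * recip D3)"
      by (simp only: mult_ac)
    then show "D2 * D3 * (D1 * (recip (D1 * D2) * recip D3)) = 1"
      by (simp add: inv)
  qed (simp add: D0)
  moreover have "b = t * y * (1 - t) * recip (D2 * D3)"
    by (simp add: b_def kernel_root_def D2_def D3_def t_def power2_eq_square power3_eq_cube mult.assoc)
  ultimately have b: "b = s * t * D1"
    by (simp add: s_def mult_ac)
  have ba: "b - t * a = s * (t ^ 2 * y * (1 - t ^ 2))"
    unfolding a b D1_def D3_def by (simp add: algebra_simps eval_nat_numeral)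
  have ab: "a - t * b = s * (1 - t ^ 2)"
    unfolding a b D1_def D3_def by (simp add: algebra_simps eval_nat_numeral)
  have ba2: "b - 2 * t * a = - s * t * (1 - t * y * c)"
    unfolding a b D1_def D3_def c_def t_def by (simp add: algebra_simps eval_nat_numeral)
  have ab2: "a - 2 * t * b = s * (c - t ^ 3 * y)"
    unfolding a b D1_def D3_def c_def t_def by (simp add: algebra_simps eval_nat_numeral)
  have s: "s * (D1 * D2 * D3) = y * (1 - t)"
  proof -
    have "s * (D1 * D2 * D3) = y * (1 - t) * (D1 * D2 * recip (D1 * D2)) * (D3 * recip D3)"
      by (simp only: s_def mult_ac)
    then show ?thesis by (simp add: inv)
  qed
  have apb: "a + b = s * ((1 + t) * D2)"
    unfolding a b D1_def D3_def D2_def by (simp add: algebra_simps eval_nat_numeral)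
  have kernel: "(b - t * a) * (a - t * b) - t * (a + b) * (a * b * (1 - t ^ 2)) = 0"
  proof -
    have "t * (a + b) * (a * b * (1 - t ^ 2)) = t ^ 2 * s ^ 2 * (1 + t) * (1 - t ^ 2) * (s * (D1 * D2 * D3))"
      unfolding apb unfolding a b by (simp only: power2_eq_square mult_ac)
    also have "\<dots> = t ^ 2 * s ^ 2 * (1 - t ^ 2) * y * ((1 + t) * (1 - t))"
      unfolding s by (simp only: mult_ac)
    also have "(1 + t) * (1 - t) = 1 - t ^ 2"
      by (simp add: algebra_simps power2_eq_square)
    also have "t ^ 2 * s ^ 2 * (1 - t ^ 2) * y * (1 - t ^ 2) = (b - t * a) * (a - t * b)"
      unfolding ba ab by (simp add: power2_eq_square mult_ac)
    finally show ?thesis by simp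
  qed
  have ca: "corner_gf a = t * (1 - t ^ 2) * y * normalized_right y"
    unfolding a_def t_def by (rule corner_gf_kernel_root) fact
  have cb: "corner_gf b = t * (1 - t ^ 2) * (t * y) * normalized_right (t * y)"
    unfolding b_def t_def using assms(1) by (intro corner_gf_kernel_root) simp
  have "s ^ 2 * (t ^ 2 * y * (1 - t ^ 2) ^ 2) *
      (1 - (1 - t * y * c) * normalized_right y
         + t ^ 2 * y * (c - t ^ 3 * y) * normalized_right (t * y)) =
      (b - t * a) * (a - t * b) + (a - t * b) * (b - 2 * t * a) * corner_gf a
        + (b - t * a) * (a - 2 * t * b) * corner_gf b"
    unfolding ba ab ba2 ab2 ca cb by (simp add: algebra_simps power2_eq_square)
  also have "\<dots> = 0"
    using kernel_equation[of b a] kernel unfolding t_def by simp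
  finally have "s ^ 2 * (t ^ 2 * y * (1 - t ^ 2) ^ 2) *
      (1 - (1 - t * y * c) * normalized_right y
         + t ^ 2 * y * (c - t ^ 3 * y) * normalized_right (t * y)) = 0" .
  moreover have "s \<noteq> 0"
    using s assms(1) one_minus_X_nonzero(1) by (auto simp: t_def)
  then have "s ^ 2 * (t ^ 2 * y * (1 - t ^ 2) ^ 2) \<noteq> 0"
    using assms(1) one_minus_X_nonzero(2) unfolding t_def
    by (simp only: mult_eq_0_iff power_eq_0_iff fps_X_neq_zero) simp
  ultimately have "1 - (1 - t * y * c) * normalized_right y
      + t ^ 2 * y * (c - t ^ 3 * y) * normalized_right (t * y) = 0"
    by (simp only: mult_eq_0_iff simp_thms)
  then show ?thesis by (simp add: algebra_simps)
qed

text \<open>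
  After \<open>N\<close> iterations the remaining term carries the product of \<open>N\<close> factors \<open>G\<close> and hence tends
  to 0 in the \<open>t\<close>-adic topology.
\<close>

lemma iterate_linear_recursion:
  fixes F G \<sigma> :: "nat \<Rightarrow> 'a::comm_ring_1 fps"
  assumes step: "\<And>k. F k * \<sigma> k = 1 + G k * \<sigma> (Suc k)"
    and F: "\<And>k. F k $ 0 = 1" and G: "\<And>k. fps_X dvd G k"
  shows "(\<lambda>k. (\<Prod>i<k. G i) * recip (\<Prod>i<Suc k. F i)) sums \<sigma> 0"
proof (rule sums_fpsI)
  fix N
  have F0: "(\<Prod>i<k. F i) $ 0 = 1" for k
    by (induction k) (simp_all add: F)
  have "\<sigma> 0 = (\<Sum>k<N. (\<Prod>i<k. G i) * recip (\<Prod>i<Suc k. F i)) + (\<Prod>i<N. G i) * (recip (\<Prod>i<N. F i) * \<sigma> N)"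
  proof (induction N)
    case 0
    show ?case by (simp add: recip_eqI)
  next
    case (Suc N)
    have recip_step: "recip (\<Prod>i<N. F i) = recip (\<Prod>i<Suc N. F i) * F N"
    proof (rule recip_eqI[OF F0])
      have "(\<Prod>i<N. F i) * (recip (\<Prod>i<Suc N. F i) * F N) = (\<Prod>i<Suc N. F i) * recip (\<Prod>i<Suc N. F i)"
        by (simp add: mult_ac)
      then show "(\<Prod>i<N. F i) * (recip (\<Prod>i<Suc N. F i) * F N) = 1"
        by (simp only: mult_recip[OF F0])
    qed
    have distrib: "r * (1 + g * s) = r + g * (r * s)" for r g s :: "'a fps"
      by (simp add: algebra_simps)
    from recip_step have "recip (\<Prod>i<N. F i) * \<sigma> N = recip (\<Prod>i<Suc N. F i) * (F N * \<sigma> N)"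
      by (simp only: mult.assoc)
    also have "\<dots> = recip (\<Prod>i<Suc N. F i) + G N * (recip (\<Prod>i<Suc N. F i) * \<sigma> (Suc N))"
      unfolding step by (rule distrib)
    finally have *: "recip (\<Prod>i<N. F i) * \<sigma> N =
        recip (\<Prod>i<Suc N. F i) + G N * (recip (\<Prod>i<Suc N. F i) * \<sigma> (Suc N))" .
    show ?case
      by (subst Suc.IH, subst *)
         (simp only: distrib_left add.assoc mult.assoc sum.lessThan_Suc prod.lessThan_Suc)
  qed
  then have "\<sigma> 0 - (\<Sum>k<N. (\<Prod>i<k. G i) * recip (\<Prod>i<Suc k. F i)) =
      (\<Prod>i<N. G i) * (recip (\<Prod>i<N. F i) * \<sigma> N)"
    by (rule trans[OF arg_cong[where f = "\<lambda>z. z - _"]]) (rule add_diff_cancel_left')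
  moreover have "fps_X ^ N dvd (\<Prod>i<N. G i)"
    using prod_dvd_prod[of "{..<N}" "\<lambda>_. fps_X" G] G by simp
  ultimately show "fps_X ^ N dvd \<sigma> 0 - (\<Sum>k<N. (\<Prod>i<k. G i) * recip (\<Prod>i<Suc k. F i))"
    by (simp only: dvd_mult2)
qed

lemma series_fps_const: "series (\<lambda>n. fps_const (f $ n)) = f"
proof (rule series_eqI, rule fps_X_power_dvd)
  fix N m :: nat assume "m < N"
  have "(\<Sum>n<N. fps_X ^ n * fps_const (f $ n)) $ m = (\<Sum>n<N. if n = m then f $ n else 0)"
    unfolding fps_sum_nth by (intro sum.cong) (auto simp: fps_X_power_mult_nth)
  then show "(f - (\<Sum>n<N. fps_X ^ n * fps_const (f $ n))) $ m = 0"
    using \<open>m < N\<close> by simp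
qed

lemma P_gf_based: "P_gf = 1 + 3 * gf (based Right) (fps_const [:0, 1:]) (fps_const [:0, 1:])"
proof -
  let ?U = "fps_const [:0, 1:] :: int poly fps"
  have const_sum: "fps_const (\<Sum>w\<in>V. f w) = (\<Sum>w\<in>V. fps_const (f w))" for f :: "walk \<Rightarrow> int poly" and V
    by (induction V rule: infinite_finite_induct) (simp_all flip: fps_const_add)
  have coeff: "fps_const (P_gf $ n) = (\<Sum>w\<in>prudent_walks n. ?U ^ box_size w)" for n
    by (simp add: P_gf_def prudent_walks_def const_sum fps_const_power monom_altdef)
  have "P_gf = series (\<lambda>n. \<Sum>w\<in>prudent_walks n. ?U ^ box_size w)"
    unfolding coeff[symmetric] series_fps_const ..
  also have "\<dots> = 1 + fps_X * series (\<lambda>n. 3 * weight_sum (based Right (Suc n)) ?U ?U)"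
    by (subst series_Suc) (simp add: prudent_walks_0 sum_size_prudent_Suc box_coords(2)[of "[]"]
      del: fps_const_power)
  also have "\<dots> = 1 + 3 * gf (based Right) ?U ?U"
    unfolding gf_def series_mult by (subst (2) series_Suc) simp
  finally show ?thesis .
qed

text \<open>
  On the diagonal, the equation for the sliding walks can be divided by \<open>a\<close>, and the two kinds of
  sliding walks have the same series.
\<close>

lemma gf_based_diagonal:
  fixes a :: "'a::idom fps"
  assumes "a \<noteq> 0"
  defines "t \<equiv> fps_X"
  shows "(1 - t - 2 * t * a * (1 + t)) * gf (based Right) a a =
    2 * t * a * (1 + t) * (1 + t * (2 * a * (1 + t) - 1) * gf walks_right a (t * a))"
proof -
  define T where "T = gf (based Right) a a"
  define Y where "Y = gf (sliding NW) a a"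
  define A where "A = gf inflated a a"
  define C where "C = corner_gf a"
  have "a * ((1 - t) * Y) = a * (t * (A - C))"
    using gf_sliding[of a a] by (simp add: Y_def A_def C_def t_def corner_gf_eq algebra_simps)
  then have Y: "(1 - t) * Y = t * (A - C)"
    using assms(1) by simp
  have T: "T = A + 2 * Y"
    by (simp add: T_def A_def Y_def gf_based)
  have A: "A = t * (a + a) * (1 + T + C + C)"
    by (simp add: A_def T_def C_def t_def gf_inflated gf_walks_right)
  have "(1 - t) * T = (1 - t) * A + 2 * ((1 - t) * Y)"
    by (simp add: T algebra_simps)
  also have "\<dots> = (1 + t) * A - 2 * t * C"
    unfolding Y by (simp add: algebra_simps)
  also have "\<dots> = 2 * t * a * (1 + t) * (1 + T + C + C) - 2 * t * C"
    by (subst A) (simp add: algebra_simps)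
  finally have "(1 - t - 2 * t * a * (1 + t)) * T = 2 * t * a * (1 + t) * (1 + C + C) - 2 * t * C"
    by (simp add: algebra_simps)
  also have "C = t * (1 + t) * a * gf walks_right a (t * a)"
    unfolding C_def t_def by (rule corner_gf_closed) fact
  finally show ?thesis
    unfolding T_def by (simp add: algebra_simps)
qed

theorem proposition10:
  fixes t x u U :: "int poly fps" and S :: "nat \<Rightarrow> int poly fps"
  defines "t \<equiv> fps_X"
    and "x \<equiv> fps_const [:0, 1:]"
    and "u \<equiv> x * (1 - t) * recip ((1 + t * x) * (1 + t^2 * x))"
    and "S \<equiv> (\<lambda>k. t ^ ((k + 1) choose 2) * (x * t * (1 - 2 * t^2)) ^ k
            * recip (qpoch (x * t * (1 - 2 * t^2)) t (k + 1))
            * qpoch (x * t^3 * recip (1 - 2 * t^2)) t k)"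
    and "U \<equiv> fps_const [:0, 1:]"
  shows "(summable S \<and>
          subst2 R_gf u (t * u) = (1 + x * t) * (1 + x * t^2) * (\<Sum>k. S k)) \<and>
         P_gf = 1 + 6 * t * U * (1 + t) * recip (1 - t - 2 * t * U * (1 + t))
           * (1 + t * (2 * U * (1 + t) - 1) * subst2 R_gf U (t * U))"
proof -
  have x: "x \<noteq> 0" and U: "U \<noteq> 0"
    by (simp_all add: x_def U_def)
  define c where "c = 1 - 2 * t ^ 2"
  have c: "c * recip c = 1"
    by (rule mult_recip) (simp add: c_def t_def)
  define F where "F k = 1 - x * t * c * t ^ k" for k
  define G where "G k = t ^ 2 * (t ^ k * x) * (c - t ^ 3 * (t ^ k * x))" for k
  define \<sigma> where "\<sigma> k = normalized_right (t ^ k * x)" for k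
  have "(\<lambda>k. (\<Prod>i<k. G i) * recip (\<Prod>i<Suc k. F i)) sums \<sigma> 0"
  proof (rule iterate_linear_recursion)
    show "F k * \<sigma> k = 1 + G k * \<sigma> (Suc k)" for k
      using normalized_right_step[of "t ^ k * x"] x
      by (simp add: F_def G_def \<sigma>_def c_def t_def mult_ac)
    show "F k $ 0 = 1" for k
      by (simp add: F_def t_def mult.assoc mult.left_commute[of x])
    show "fps_X dvd G k" for k
      by (simp add: G_def t_def power2_eq_square mult.assoc)
  qed
  \<comment> \<open>Extracting \<open>c\<close> from the second factor of \<open>G i\<close> exhibits it as a q-Pochhammer factor;
     the powers \<open>t ^ (i + 1)\<close> that remain multiply up to the binomial exponent.\<close>
  moreover have "(\<Prod>i<k. G i) = t ^ ((k + 1) choose 2) * (x * t * c) ^ k * qpoch (x * t ^ 3 * recip c) t k" for k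
  proof (induction k)
    case (Suc k)
    have choose: "(Suc k + 1) choose 2 = ((k + 1) choose 2) + Suc k"
      by (simp add: numeral_2_eq_2)
    have "G k = t ^ 2 * t ^ k * x * (c - (c * recip c) * t ^ 3 * t ^ k * x)"
      by (simp add: G_def c mult.assoc)
    also have "\<dots> = t ^ Suc k * (x * t * c) * (1 - x * t ^ 3 * recip c * t ^ k)"
      by (simp add: algebra_simps power2_eq_square)
    finally show ?case
      unfolding choose using Suc.IH by (simp add: qpoch_def power_add mult_ac)
  qed (simp add: qpoch_def numeral_2_eq_2)
  moreover have "(\<Prod>i<Suc k. F i) = qpoch (x * t * c) t (k + 1)" for k
    by (simp add: qpoch_def F_def)
  ultimately have "S sums \<sigma> 0"
    by (simp add: S_def c_def mult_ac)
  then have S: "summable S" "(\<Sum>k. S k) = \<sigma> 0"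
    by (auto simp: sums_iff)
  have "(1 + x * t) * (1 + x * t^2) * \<sigma> 0 =
      ((1 + t * x) * (1 + t ^ 2 * x) * recip ((1 + t * x) * (1 + t ^ 2 * x))) * gf walks_right u (t * u)"
    by (simp add: \<sigma>_def normalized_right_def kernel_root_def u_def t_def mult_ac)
  also have "\<dots> = subst2 R_gf u (t * u)"
    by (subst mult_recip) (simp_all add: t_def subst2_R_gf)
  finally have R: "subst2 R_gf u (t * u) = (1 + x * t) * (1 + x * t^2) * (\<Sum>k. S k)"
    by (simp only: S)
  let ?D = "1 - t - 2 * t * U * (1 + t)"
  have D: "?D * recip ?D = 1"
    by (rule mult_recip) (simp add: t_def)
  have "gf (based Right) U U = (?D * recip ?D) * gf (based Right) U U"
    by (simp only: D mult_1_left)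
  also have "\<dots> = recip ?D * (?D * gf (based Right) U U)"
    by (simp only: mult_ac)
  also have "?D * gf (based Right) U U =
      2 * t * U * (1 + t) * (1 + t * (2 * U * (1 + t) - 1) * subst2 R_gf U (t * U))"
    using gf_based_diagonal[OF U] by (simp only: t_def subst2_R_gf)
  finally have P: "P_gf = 1 + 3 * (recip ?D *
      (2 * t * U * (1 + t) * (1 + t * (2 * U * (1 + t) - 1) * subst2 R_gf U (t * U))))"
    by (simp only: P_gf_based U_def)
  have rearrange: "3 * (d * (2 * a * b * e * f)) = 6 * a * b * e * d * f"
    for a b d e f :: "int poly fps"
    by (simp add: mult_ac)
  note P
  also have "1 + 3 * (recip ?D *
      (2 * t * U * (1 + t) * (1 + t * (2 * U * (1 + t) - 1) * subst2 R_gf U (t * U)))) =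
      1 + 6 * t * U * (1 + t) * recip ?D
      * (1 + t * (2 * U * (1 + t) - 1) * subst2 R_gf U (t * U))"
    by (simp only: rearrange)
  finally show ?thesis
    using S R by blast
qed

end
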